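(* Let $S$ be a numerical semigroup with multiplicity $m(S)$, embedding dimension $\nu(S)$ and Frobenius number $f(S)$. If $2\nu(S) \geq m(S)$, then $S$ satisfies Wilf's conjecture, that is, $f(S)+1 \leq n(S)\,\nu(S)$.
   Context: $\mathbb{N}$ denotes the natural numbers including $0$. A numerical semigroup is a submonoid $S$ of $(\mathbb{N},+)$ with finite complement in $\mathbb{N}$. The Frobenius number $f(S)$ is the largest integer not belonging to $S$. The multiplicity $m(S)$ is the least positive element of $S$. The embedding dimension $\nu(S)$ is the number of elements of the unique minimal system of generators of $S$. Finally $n(S)=|\{s\in S : s<f(S)\}| = |S\cap[0,f(S)]|$. *)

theory Defs
  imports Main "HOL.Hull"
begin

definition nat_submonoid :: "nat set \<Rightarrow> bool" where
  "nat_submonoid S \<longleftrightarrow> 0 \<in> S \<and> (\<forall>a\<in>S. \<forall>b\<in>S. a + b \<in> S)"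

definition numerical_semigroup :: "nat set \<Rightarrow> bool" where
  "numerical_semigroup S \<longleftrightarrow> nat_submonoid S \<and> finite (- S)"

text \<open>The Frobenius number is an integer: it is \<open>-1\<close> for \<open>S = UNIV\<close>.\<close>

definition frobenius_number :: "nat set \<Rightarrow> int" where
  "frobenius_number S = (GREATEST z. z \<notin> int ` S)"

definition multiplicity_ns :: "nat set \<Rightarrow> nat" where
  "multiplicity_ns S = (LEAST s. s \<in> S \<and> s > 0)"

text \<open>\<open>nat_submonoid hull A\<close> is the submonoid generated by \<open>A\<close>.\<close>

definition minimal_generating_system :: "nat set \<Rightarrow> nat set \<Rightarrow> bool" where
  "minimal_generating_system S A \<longleftrightarrow>
     nat_submonoid hull A = S \<and> (\<forall>B. B \<subset> A \<longrightarrow> nat_submonoid hull B \<noteq> S)"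

definition embedding_dimension :: "nat set \<Rightarrow> nat" where
  "embedding_dimension S = card (THE A. minimal_generating_system S A)"

definition num_small_elements :: "nat set \<Rightarrow> nat" where
  "num_small_elements S = card {s \<in> S. int s < frobenius_number S}"

text \<open>The descriptions with \<open>GREATEST\<close>, \<open>LEAST\<close> and \<open>THE\<close> above denote what they should for
  every numerical semigroup.\<close>

lemma frobenius_number_greatest:
  assumes "numerical_semigroup S"
  shows "frobenius_number S \<notin> int ` S" "z \<notin> int ` S \<Longrightarrow> z \<le> frobenius_number S"
proof -
  define F where "F = insert (-1) (int ` (- S))"
  have fin: "finite F" and ne: "F \<noteq> {}"
    using assms by (auto simp: F_def numerical_semigroup_def)
  have max: "Max F \<in> F" using fin ne by (rule Max_in)
  have 1: "Max F \<notin> int ` S" using max by (auto simp: F_def)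
  have 2: "z \<le> Max F" if z: "z \<notin> int ` S" for z
  proof (cases "z < 0")
    case True
    moreover have "-1 \<le> Max F" using fin by (auto simp: F_def)
    ultimately show ?thesis by linarith
  next
    case False
    then obtain n where "z = int n" by (metis nonneg_int_cases not_less)
    then have "z \<in> F" using z by (auto simp: F_def)
    then show ?thesis using fin by simp
  qed
  have eq: "frobenius_number S = Max F"
    unfolding frobenius_number_def using 1 2 by (intro Greatest_equality) auto
  show "frobenius_number S \<notin> int ` S" using 1 eq by simp
  show "z \<notin> int ` S \<Longrightarrow> z \<le> frobenius_number S" using 2 eq by simp
qed

lemma multiplicity_ns_least:
  assumes "numerical_semigroup S"
  shows "multiplicity_ns S \<in> S" "multiplicity_ns S > 0"
    "s \<in> S \<Longrightarrow> s > 0 \<Longrightarrow> multiplicity_ns S \<le> s"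
proof -
  have "infinite S"
    using assms finite_compl[of S] by (auto simp: numerical_semigroup_def)
  then have "\<not> S \<subseteq> {0}" using finite_subset by blast
  then obtain t where "t \<in> S \<and> t > 0" using gr0I by blast
  then have "multiplicity_ns S \<in> S \<and> multiplicity_ns S > 0"
    unfolding multiplicity_ns_def by (rule LeastI)
  then show "multiplicity_ns S \<in> S" "multiplicity_ns S > 0" by auto
  show "s \<in> S \<Longrightarrow> s > 0 \<Longrightarrow> multiplicity_ns S \<le> s"
    unfolding multiplicity_ns_def by (simp add: Least_le)
qed

definition ns_atoms :: "nat set \<Rightarrow> nat set" where
  "ns_atoms S = {s \<in> S - {0}. \<forall>a\<in>S - {0}. \<forall>b\<in>S - {0}. s \<noteq> a + b}"

lemma nat_submonoid_hull: "nat_submonoid (nat_submonoid hull A)"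
  unfolding hull_def nat_submonoid_def by auto

lemma nat_submonoid_zero: "nat_submonoid S \<Longrightarrow> 0 \<in> S"
  and nat_submonoid_add: "nat_submonoid S \<Longrightarrow> a \<in> S \<Longrightarrow> b \<in> S \<Longrightarrow> a + b \<in> S"
  by (auto simp: nat_submonoid_def)

lemma hull_ns_atoms:
  assumes S: "nat_submonoid S"
  shows "nat_submonoid hull ns_atoms S = S"
proof
  show "nat_submonoid hull ns_atoms S \<subseteq> S"
    by (rule hull_minimal) (use S in \<open>auto simp: ns_atoms_def\<close>)
  show "S \<subseteq> nat_submonoid hull ns_atoms S"
  proof
    fix s assume "s \<in> S"
    then show "s \<in> nat_submonoid hull ns_atoms S"
    proof (induction s rule: less_induct)
      case (less s)
      consider "s = 0" | "s \<in> ns_atoms S"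
        | a b where "a \<in> S - {0}" "b \<in> S - {0}" "s = a + b"
        using less.prems unfolding ns_atoms_def by blast
      then show ?case
      proof cases
        case 1
        then show ?thesis by (simp add: nat_submonoid_zero nat_submonoid_hull)
      next
        case 2
        then show ?thesis by (rule hull_inc)
      next
        case 3
        then have "a \<in> nat_submonoid hull ns_atoms S" "b \<in> nat_submonoid hull ns_atoms S"
          by (auto intro!: less.IH)
        then show ?thesis using 3(3) by (simp add: nat_submonoid_add nat_submonoid_hull)
      qed
    qed
  qed
qed

lemma ns_atoms_subset:
  assumes "nat_submonoid hull A = S"
  shows "ns_atoms S \<subseteq> A"
proof
  fix s assume s: "s \<in> ns_atoms S"
  have S: "nat_submonoid S" using nat_submonoid_hull[of A] assms by simp
  show "s \<in> A"
  proof (rule ccontr)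
    assume "s \<notin> A"
    moreover have "A \<subseteq> S" using hull_subset[of A nat_submonoid] assms by simp
    ultimately have "A \<subseteq> S - {s}" by blast
    moreover have "nat_submonoid (S - {s})"
      unfolding nat_submonoid_def
    proof (intro conjI ballI)
      show "0 \<in> S - {s}" using S s by (auto simp: nat_submonoid_def ns_atoms_def)
      fix a b assume ab: "a \<in> S - {s}" "b \<in> S - {s}"
      have "a + b \<in> S" using S ab by (auto simp: nat_submonoid_def)
      moreover have "a + b \<noteq> s"
        using s ab by (cases "a = 0"; cases "b = 0") (auto simp: ns_atoms_def)
      ultimately show "a + b \<in> S - {s}" by blast
    qed
    ultimately have "nat_submonoid hull A \<subseteq> S - {s}" by (rule hull_minimal)
    then show False using assms s by (auto simp: ns_atoms_def)
  qed
qed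

lemma minimal_generating_system_iff:
  assumes "nat_submonoid S"
  shows "minimal_generating_system S A \<longleftrightarrow> A = ns_atoms S"
proof
  assume A: "minimal_generating_system S A"
  then have "ns_atoms S \<subseteq> A"
    by (intro ns_atoms_subset) (simp add: minimal_generating_system_def)
  moreover have "\<not> ns_atoms S \<subset> A"
    using A hull_ns_atoms[OF assms] unfolding minimal_generating_system_def by auto
  ultimately show "A = ns_atoms S" by auto
next
  assume A: "A = ns_atoms S"
  have "nat_submonoid hull B \<noteq> S" if "B \<subset> A" for B
    using that ns_atoms_subset[of B S] A by auto
  then show "minimal_generating_system S A"
    using A hull_ns_atoms[OF assms] by (simp add: minimal_generating_system_def)
qed

lemma embedding_dimension_eq:
  assumes "nat_submonoid S"
  shows "embedding_dimension S = card (ns_atoms S)"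
  using assms by (simp add: embedding_dimension_def minimal_generating_system_iff)

lemma finite_ns_atoms:
  assumes S: "numerical_semigroup S"
  shows "finite (ns_atoms S)"
proof -
  define m where "m = multiplicity_ns S"
  have m: "m \<in> S" "m > 0" using multiplicity_ns_least[OF S] by (auto simp: m_def)
  have "ns_atoms S \<subseteq> insert m ((\<lambda>n. n + m) ` (- S) \<union> {..<m})"
  proof
    fix s assume s: "s \<in> ns_atoms S"
    show "s \<in> insert m ((\<lambda>n. n + m) ` (- S) \<union> {..<m})"
    proof (cases "s \<le> m")
      case False
      then have "s = (s - m) + m" "s - m \<noteq> 0" by auto
      moreover have "s - m \<notin> S"
      proof
        assume "s - m \<in> S"
        then have "s - m \<in> S - {0}" "m \<in> S - {0}" using False m by auto
        then have "s \<noteq> (s - m) + m" using s unfolding ns_atoms_def by blast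
        then show False using False by simp
      qed
      ultimately show ?thesis by blast
    qed auto
  qed
  then show ?thesis
    by (rule finite_subset) (use S in \<open>auto simp: numerical_semigroup_def\<close>)
qed

end

theory Submission
  imports Defs
begin

text \<open>
  Write \<open>m\<close>, \<open>e\<close>, \<open>f\<close>, \<open>n\<close> for the multiplicity, the embedding dimension, the Frobenius number
  and the number of small elements. The Apery set \<open>apery S m\<close> consists of the least
  element of \<open>S\<close> in each residue class modulo \<open>m\<close>, and its maximum is \<open>F = f + m\<close>. Its elements
  are \<open>0\<close>, the atoms different from \<open>m\<close>, and a set \<open>D\<close> of decomposable elements, so
  \<open>m = e + card D\<close> and the hypothesis says \<open>card D \<le> e\<close>.

  An Apery element \<open>w\<close> accounts for \<open>height w = (F - w) div m\<close> elements of \<open>S\<close> up to \<open>f\<close>. Put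
  \<open>q = height 0\<close>, let \<open>T\<close> be the sum of the heights of the nonzero Apery elements and write
  \<open>f + 1 = q * m - \<rho>\<close> with \<open>0 \<le> \<rho> < m\<close>. As \<open>n = q + T\<close>, Wilf's inequality becomes
  \<open>q * card D \<le> e * T + \<rho>\<close> (\<open>height_bound\<close>). This is clear if \<open>q \<le> T\<close>. Otherwise every
  decomposable \<open>d = x + y\<close> helps twice. Because \<open>x + y \<le> F\<close>, the two heights add up to at least
  \<open>q - 1\<close> (\<open>height_summands\<close>). And when they add up to exactly \<open>q - 1\<close>, the two
  remainders modulo \<open>m\<close> lost in the heights are so large that \<open>d\<close> is one of the at most \<open>\<rho>\<close>
  numbers in \<open>{F - \<rho> <.. F}\<close> (\<open>summands_window\<close>).

  If all heights are below \<open>q / 2\<close>, then \<open>D\<close> lies in that window. So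
  \<open>card D \<le> min e \<rho>\<close>, and with \<open>T \<ge> q - 1\<close> the bound \<open>(q - 1) * card D + card D\<close> follows;
  only a single \<open>d = 2 * x\<close> escapes the estimate for \<open>T\<close>, and there \<open>e \<ge> 2\<close> suffices
  (\<open>height_bound_without_tall\<close>). If some \<open>x\<close> has height at least \<open>q / 2\<close>, then \<open>T < q\<close> leaves so
  little height for the other elements that \<open>D \<subseteq> {2 * x, x + y}\<close> for one \<open>y\<close>
  (\<open>height_bound_with_tall\<close>). The bound is then easy unless \<open>S\<close> is generated by \<open>4\<close> and \<open>x\<close>,
  where a parity argument finishes the proof.
\<close>

section \<open>Apery sets\<close>

definition apery :: "nat set \<Rightarrow> nat \<Rightarrow> nat set" where
  "apery S m = {w \<in> S. \<forall>s\<in>S. w \<noteq> s + m}"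

lemma nat_submonoid_mult:
  assumes "nat_submonoid S" "m \<in> S"
  shows "k * m \<in> S"
  using assms by (induction k) (auto simp: nat_submonoid_def)

lemma zero_in_apery:
  assumes "nat_submonoid S" "m > 0"
  shows "0 \<in> apery S m"
  using assms by (auto simp: apery_def nat_submonoid_def)

text \<open>If \<open>x = s + m\<close>, then \<open>x + y = (s + y) + m\<close>: a summand that is not least in its class
  would make the sum not least in its class.\<close>

lemma apery_summand:
  assumes S: "nat_submonoid S" and xy: "x \<in> S" "y \<in> S" "x + y \<in> apery S m"
  shows "x \<in> apery S m"
proof -
  have "x \<noteq> s + m" if "s \<in> S" for s
  proof
    assume "x = s + m"
    then have "x + y = (s + y) + m" by simp
    moreover have "s + y \<in> S" using S that xy(2) by (rule nat_submonoid_add)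
    ultimately show False using xy(3) by (auto simp: apery_def)
  qed
  then show ?thesis using xy(1) by (simp add: apery_def)
qed

text \<open>Of two congruent elements of \<open>S\<close>, the larger one is the smaller one plus a positive
  multiple of \<open>m\<close>, so subtracting \<open>m\<close> once does not leave \<open>S\<close>.\<close>

lemma inj_on_mod_apery:
  assumes S: "nat_submonoid S" and m: "m \<in> S"
  shows "inj_on (\<lambda>w. w mod m) (apery S m)"
proof -
  have False if w: "v \<in> apery S m" "w \<in> apery S m" "v mod m = w mod m" "v < w" for v w
  proof -
    obtain k where k: "w = v + m * k"
      using w(3,4) mod_eq_nat2E[of v m w] by auto
    then obtain j where j: "k = Suc j" using w(4) by (cases k) auto
    have "v + j * m \<in> S"
      using w(1) S m by (simp add: apery_def nat_submonoid_add nat_submonoid_mult)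
    moreover have "w = (v + j * m) + m" using k j by (simp add: algebra_simps)
    ultimately show False using w(2) by (auto simp: apery_def)
  qed
  then show ?thesis by (metis inj_onI linorder_neqE_nat)
qed

text \<open>Reduction modulo \<open>m\<close> is a bijection from the Apery set to the residues: it is
  surjective because a cofinite \<open>S\<close> meets each residue class, and the least element there
  cannot stay in \<open>S\<close> after subtracting \<open>m\<close>.\<close>

lemma card_apery:
  assumes S: "numerical_semigroup S" and m: "m \<in> S" "m > 0"
  shows "card (apery S m) = m"
proof -
  have mon: "nat_submonoid S" using S by (simp add: numerical_semigroup_def)
  have "(\<lambda>w. w mod m) ` apery S m = {..<m}"
  proof
    show "(\<lambda>w. w mod m) ` apery S m \<subseteq> {..<m}" using m by auto
    show "{..<m} \<subseteq> (\<lambda>w. w mod m) ` apery S m"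
    proof
      fix i assume i: "i \<in> {..<m}"
      have "finite (- S)" using S by (simp add: numerical_semigroup_def)
      then obtain b where b: "\<And>s. s \<notin> S \<Longrightarrow> s < b"
        using finite_nat_set_iff_bounded[of "- S"] by auto
      have "b \<le> i + b * m" using m(2) by (cases m) auto
      then have "i + b * m \<in> S \<and> (i + b * m) mod m = i"
        using b[of "i + b * m"] i by auto
      then obtain w where w: "w \<in> S \<and> w mod m = i"
          and least: "\<And>v. v \<in> S \<and> v mod m = i \<Longrightarrow> w \<le> v"
        using exists_least_iff[of "\<lambda>w. w \<in> S \<and> w mod m = i"] by (metis not_less)
      have "w \<noteq> s + m" if "s \<in> S" for s
        using least[of s] that w m(2) by auto
      then show "i \<in> (\<lambda>w. w mod m) ` apery S m" using w by (auto simp: apery_def)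
    qed
  qed
  then show ?thesis using card_image[OF inj_on_mod_apery[OF mon m(1)]] by simp
qed

lemma ns_atoms_subset_apery:
  assumes "m \<in> S" "m > 0"
  shows "ns_atoms S - {m} \<subseteq> apery S m"
proof
  fix s assume s: "s \<in> ns_atoms S - {m}"
  have "s \<noteq> t + m" if "t \<in> S" for t
    using s that assms by (cases "t = 0") (auto simp: ns_atoms_def)
  then show "s \<in> apery S m" using s by (auto simp: apery_def ns_atoms_def)
qed

lemma multiplicity_in_ns_atoms:
  assumes "numerical_semigroup S"
  shows "multiplicity_ns S \<in> ns_atoms S"
proof -
  note least = multiplicity_ns_least[OF assms]
  have "multiplicity_ns S \<noteq> a + b" if "a \<in> S - {0}" "b \<in> S - {0}" for a b
    using that least(3)[of a] by auto
  then show ?thesis using least(1,2) by (auto simp: ns_atoms_def)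
qed

section \<open>Counting along the Apery set\<close>

locale wilf =
  fixes S :: "nat set"
  assumes numerical: "numerical_semigroup S"
begin

abbreviation "m \<equiv> multiplicity_ns S"

abbreviation "e \<equiv> card (ns_atoms S)"

text \<open>This is the largest element of the Apery set; unlike the Frobenius number it is never
  negative.\<close>

definition top_apery :: nat where
  "top_apery = nat (frobenius_number S + int m)"

abbreviation "F \<equiv> top_apery"

text \<open>For \<open>w\<close> in the Apery set, the number of elements of \<open>S\<close> that are congruent to
  \<open>w\<close> modulo \<open>m\<close> and at most the Frobenius number.\<close>

definition height :: "nat \<Rightarrow> nat" where
  "height w = (F - w) div m"

abbreviation "q \<equiv> height 0"

text \<open>The distance from \<open>f + 1\<close>, for the Frobenius number \<open>f\<close>, up to the next multiple
  \<open>q * m\<close> of \<open>m\<close>.\<close>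

definition \<rho> :: nat where
  "\<rho> = m - 1 - F mod m"

definition A :: "nat set" where
  "A = apery S m - {0}"

definition D :: "nat set" where
  "D = A - ns_atoms S"

abbreviation "T \<equiv> sum height A"

lemma monoid: "nat_submonoid S"
  using numerical by (simp add: numerical_semigroup_def)

lemma m_in: "m \<in> S" and m_pos: "m > 0" and m_le: "s \<in> S \<Longrightarrow> s > 0 \<Longrightarrow> m \<le> s"
  using multiplicity_ns_least[OF numerical] by auto

lemma int_F: "int F = frobenius_number S + int m"
proof -
  have "-1 \<notin> int ` S" by auto
  then have "-1 \<le> frobenius_number S" by (rule frobenius_number_greatest(2)[OF numerical])
  then show ?thesis using m_pos by (simp add: top_apery_def)
qed

lemma finite_apery: "finite (apery S m)"
  using card_apery[OF numerical m_in m_pos] m_pos by (metis card.infinite less_irrefl)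

lemma finite_A: "finite A"
  using finite_apery by (simp add: A_def)

lemma finite_D: "finite D"
  using finite_A by (simp add: D_def)

lemma card_A: "card A + 1 = m"
  using card_apery[OF numerical m_in m_pos] zero_in_apery[OF monoid m_pos] finite_apery m_pos
  by (simp add: A_def card_Diff_singleton)

lemma m_notin_A: "m \<notin> A"
  using monoid by (auto simp: A_def apery_def nat_submonoid_def)

lemma A_in: "x \<in> A \<Longrightarrow> x \<in> S \<and> x > m"
  using m_notin_A m_le[of x] by (cases "x = m") (auto simp: A_def apery_def)

text \<open>The Apery set has \<open>m\<close> elements. Besides \<open>0\<close> and \<open>D\<close> it contains all atoms except
  \<open>m\<close>, and the atom \<open>m\<close> makes up for the \<open>0\<close>.\<close>

lemma multiplicity_eq: "m = e + card D"
proof -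
  have "A = (ns_atoms S - {m}) \<union> D"
    using ns_atoms_subset_apery[OF m_in m_pos] m_notin_A by (auto simp: A_def D_def ns_atoms_def)
  moreover have "(ns_atoms S - {m}) \<inter> D = {}" by (auto simp: D_def)
  ultimately have "card A = card (ns_atoms S - {m}) + card D"
    using finite_D finite_ns_atoms[OF numerical] by (simp add: card_Un_disjoint)
  moreover have "card (ns_atoms S - {m}) + 1 = e"
    using multiplicity_in_ns_atoms[OF numerical] finite_ns_atoms[OF numerical]
    by (metis Suc_eq_plus1 card_Suc_Diff1)
  ultimately show ?thesis using card_A by simp
qed

lemma apery_le_F:
  assumes "w \<in> apery S m"
  shows "w \<le> F"
proof (rule ccontr)
  assume "\<not> w \<le> F"
  then have less: "frobenius_number S < int w - int m" using int_F by linarith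
  then have "int w - int m \<in> int ` S"
    using frobenius_number_greatest(2)[OF numerical, of "int w - int m"] by linarith
  then obtain s where "s \<in> S" "w = s + m" by auto
  then show False using assms by (auto simp: apery_def)
qed

lemma A_le_F: "w \<in> A \<Longrightarrow> w \<le> F"
  using apery_le_F by (simp add: A_def)

text \<open>The elements \<open>w + k * m\<close> with \<open>w\<close> in the Apery set and \<open>k < height w\<close> are small
  elements of \<open>S\<close>, and they are distinct because \<open>w\<close> is determined by its residue.\<close>

lemma sum_height_le: "q + T \<le> num_small_elements S"
proof -
  let ?P = "Sigma (apery S m) (\<lambda>w. {..<height w})"
  let ?g = "\<lambda>(w, k). w + k * m"
  have inj: "inj_on ?g ?P"
  proof (rule inj_onI, clarify)
    fix v j w k
    assume a: "v \<in> apery S m" "w \<in> apery S m" and eq: "v + j * m = w + k * m"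
    then have "v mod m = w mod m" by (metis mod_mult_self1)
    then have "v = w" using inj_on_mod_apery[OF monoid m_in] a by (auto dest: inj_onD)
    then show "v = w \<and> j = k" using eq m_pos by simp
  qed
  have sub: "?g ` ?P \<subseteq> {s \<in> S. int s < frobenius_number S}"
  proof clarify
    fix w k assume w: "w \<in> apery S m" and k: "k < height w"
    have s: "w + k * m \<in> S"
      using w m_in by (simp add: apery_def monoid nat_submonoid_add nat_submonoid_mult)
    have "(k + 1) * m \<le> height w * m" using k by (intro mult_right_mono) auto
    also have "\<dots> \<le> F - w" by (simp add: height_def)
    finally have "w + k * m + m \<le> F" using apery_le_F[OF w] by simp
    then have "int (w + k * m) \<le> frobenius_number S" using int_F by linarith
    moreover have "int (w + k * m) \<noteq> frobenius_number S"
      using s frobenius_number_greatest(1)[OF numerical] by (metis imageI)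
    ultimately show "w + k * m \<in> S \<and> int (w + k * m) < frobenius_number S" using s by simp
  qed
  have "{s \<in> S. int s < frobenius_number S} \<subseteq> {..<F}" using int_F by auto
  then have "card (?g ` ?P) \<le> num_small_elements S"
    unfolding num_small_elements_def by (intro card_mono sub) (rule finite_subset, auto)
  moreover have "card (?g ` ?P) = sum height (apery S m)"
    using finite_apery by (simp add: card_image[OF inj])
  moreover have "sum height (apery S m) = q + T"
    unfolding A_def by (rule sum.remove[OF finite_apery zero_in_apery[OF monoid m_pos]])
  ultimately show ?thesis by simp
qed

lemma F_eq: "F + 1 + \<rho> = (q + 1) * m"
proof -
  have "F mod m < m" using m_pos by simp
  then have "F mod m + 1 + \<rho> = m" by (simp add: \<rho>_def)
  moreover have "F = q * m + F mod m" by (simp add: height_def)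
  ultimately show ?thesis by (simp add: algebra_simps)
qed

section \<open>Decomposable elements\<close>

lemma D_obtain:
  assumes "d \<in> D"
  obtains x y where "x \<in> A" "y \<in> A" "d = x + y"
proof -
  obtain x y where xy: "x \<in> S - {0}" "y \<in> S - {0}" "d = x + y"
    using assms unfolding D_def A_def apery_def ns_atoms_def by blast
  have "x + y \<in> apery S m" using assms xy(3) by (simp add: D_def A_def)
  moreover from this have "y + x \<in> apery S m" by (simp add: add.commute)
  ultimately have "x \<in> A" "y \<in> A" using xy apery_summand[OF monoid] by (auto simp: A_def)
  then show thesis using that xy(3) by blast
qed

lemma F_less_height: "w \<le> F \<Longrightarrow> F < w + (height w + 1) * m"
proof -
  assume "w \<le> F"
  have "F - w = height w * m + (F - w) mod m" by (simp add: height_def)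
  moreover have "(F - w) mod m < m" using m_pos by simp
  ultimately show ?thesis using \<open>w \<le> F\<close> by (simp add: algebra_simps)
qed

text \<open>\<open>F - x\<close> and \<open>F - y\<close> add up to at least \<open>F\<close>, and rounding them down to multiples of \<open>m\<close>
  loses less than \<open>2 * m\<close>.\<close>

lemma height_summands:
  assumes "x \<in> A" "y \<in> A" "x + y \<le> F"
  shows "q \<le> height x + height y + 1"
proof -
  have "F < x + (height x + 1) * m" "F < y + (height y + 1) * m"
    using assms A_le_F F_less_height by auto
  then have "F < (height x + height y + 2) * m" using assms(3) by (simp add: algebra_simps)
  moreover have "q * m \<le> F" by (simp add: height_def)
  ultimately have "q * m < (height x + height y + 2) * m" by linarith
  then have "q < height x + height y + 2" by (simp only: mult_less_cancel2)
  then show ?thesis by simp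
qed

text \<open>The case in which \<open>height_summands\<close> is sharp. Rounding loses at most \<open>m - 1\<close> for each
  summand, so \<open>2 * F - (x + y)\<close> is at most \<open>(q - 1) * m + 2 * (m - 1)\<close>, which is
  \<open>F + \<rho> - 1\<close>. Hence such sums take at most \<open>\<rho>\<close> values up to \<open>F\<close>.\<close>

lemma summands_window:
  assumes "x \<in> A" "y \<in> A" "height x + height y < q"
  shows "F < x + y + \<rho>"
proof -
  have "F + 1 \<le> x + (height x + 1) * m" "F + 1 \<le> y + (height y + 1) * m"
    using assms A_le_F F_less_height by (auto simp: Suc_le_eq)
  then have "2 * F + 2 \<le> x + y + (height x + height y + 2) * m" by (simp add: algebra_simps)
  also have "\<dots> \<le> x + y + (q + 1) * m" using assms(3) by (intro add_left_mono mult_right_mono) auto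
  also have "\<dots> = x + y + (F + 1 + \<rho>)" using F_eq by simp
  finally show ?thesis by simp
qed

text \<open>The other summand exceeds \<open>m\<close>, so \<open>y\<close> stays below \<open>F - m\<close>.\<close>

lemma height_summand_pos:
  assumes "x \<in> A" "x + y \<le> F"
  shows "height y > 0"
proof -
  have "m \<le> F - y" using assms(2) A_in[OF assms(1)] by linarith
  then show ?thesis using m_pos by (simp add: height_def div_greater_zero_iff)
qed

lemma sum_height_mono:
  assumes "X \<subseteq> A"
  shows "sum height X \<le> T"
  using assms finite_A by (intro sum_mono2) auto

lemma two_le_T: "x \<in> A \<Longrightarrow> y \<in> A \<Longrightarrow> x \<noteq> y \<Longrightarrow> height x + height y \<le> T"
  using sum_height_mono[of "{x, y}"] by simp

lemma three_le_T:
  "x \<in> A \<Longrightarrow> y \<in> A \<Longrightarrow> z \<in> A \<Longrightarrow> x \<noteq> y \<Longrightarrow> x \<noteq> z \<Longrightarrow> y \<noteq> z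
    \<Longrightarrow> height x + height y + height z \<le> T"
  using sum_height_mono[of "{x, y, z}"] by simp

lemma D_le_F: "d \<in> D \<Longrightarrow> d \<le> F"
  using A_le_F by (simp add: D_def)

text \<open>Together with \<open>0\<close>, a decomposable element and one of its summands are three Apery
  elements, so \<open>m \<ge> 3\<close>.\<close>

lemma two_le_e:
  assumes large: "m \<le> 2 * e" and "d \<in> D"
  shows "2 \<le> e"
proof -
  obtain x y where xy: "x \<in> A" "y \<in> A" "d = x + y" using D_obtain[OF assms(2)] .
  then have "card {x, d} = 2" using A_in[of y] m_pos by simp
  moreover have "{x, d} \<subseteq> A" using assms(2) xy(1) by (auto simp: D_def)
  ultimately have "2 \<le> card A" using finite_A by (metis card_mono)
  then show ?thesis using card_A large by linarith
qed

text \<open>Without a tall element, one of height at least \<open>q / 2\<close>, every sum in \<open>D\<close> is in the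
  sharp case, so \<open>card D \<le> \<rho>\<close>. Two different summands give \<open>T \<ge> q - 1\<close>; if there are only
  sums \<open>x + x\<close>, two of them do the same.\<close>

lemma height_bound_without_tall:
  assumes large: "m \<le> 2 * e" and ne: "D \<noteq> {}"
    and low: "\<And>w. w \<in> A \<Longrightarrow> 2 * height w < q"
  shows "q * card D \<le> e * T + \<rho>"
proof -
  have "D \<subseteq> {F - \<rho> <.. F}"
  proof
    fix d assume d: "d \<in> D"
    obtain x y where xy: "x \<in> A" "y \<in> A" "d = x + y" using D_obtain[OF d] .
    have "F < d + \<rho>" using summands_window[OF xy(1,2)] low[OF xy(1)] low[OF xy(2)] xy(3) by simp
    then show "d \<in> {F - \<rho> <.. F}" using D_le_F[OF d] A_in[OF xy(1)] xy(3) by auto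
  qed
  then have "card D \<le> card {F - \<rho> <.. F}" by (intro card_mono) auto
  then have rho: "card D \<le> \<rho>" by simp
  have e: "2 \<le> e" "card D \<le> e" using two_le_e[OF large] ne multiplicity_eq large by auto
  obtain d where d: "d \<in> D" using ne by blast
  obtain x y where xy: "x \<in> A" "y \<in> A" "d = x + y" using D_obtain[OF d] .
  have hd: "q \<le> height x + height y + 1" using height_summands xy D_le_F[OF d] by blast
  consider "q \<le> T + 1" | "x = y" "card D = 1"
  proof (cases "x = y")
    case False
    then show thesis using that(1) two_le_T[OF xy(1,2)] hd by linarith
  next
    case True
    show thesis
    proof (cases "D = {d}")
      case True
      then show thesis using that(2) \<open>x = y\<close> by simp
    next
      case False
      then obtain d' where d': "d' \<in> D" "d' \<noteq> d" using d by blast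
      obtain u v where uv: "u \<in> A" "v \<in> A" "d' = u + v" using D_obtain[OF d'(1)] .
      have hd': "q \<le> height u + height v + 1" using height_summands uv D_le_F[OF d'(1)] by blast
      show thesis
      proof (cases "u = v")
        case False
        then show thesis using that(1) two_le_T[OF uv(1,2)] hd' by linarith
      next
        case True
        then have "x \<noteq> u" using d'(2) xy(3) uv(3) \<open>x = y\<close> by auto
        then show thesis
          using that(1) two_le_T[OF xy(1) uv(1)] hd hd' \<open>x = y\<close> \<open>u = v\<close> by simp
      qed
    qed
  qed
  then show ?thesis
  proof cases
    case 1
    have "q * card D \<le> (T + 1) * card D" using 1 by (rule mult_right_mono) simp
    also have "\<dots> = card D * T + card D" by simp
    also have "\<dots> \<le> e * T + \<rho>" using e(2) rho by (intro add_mono mult_right_mono) auto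
    finally show ?thesis .
  next
    case 2
    have "height x \<le> T" using sum_height_mono[of "{x}"] xy(1) by simp
    moreover have "2 * T \<le> e * T" using e(1) by (rule mult_right_mono) simp
    moreover have "q \<le> 2 * height x + 1" using hd 2(1) by simp
    moreover have "1 \<le> \<rho>" using rho 2(2) by simp
    ultimately have "q \<le> e * T + \<rho>" by linarith
    then show ?thesis using 2(2) by simp
  qed
qed

text \<open>A tall \<open>x\<close> uses up so much of \<open>T\<close> that it must be a summand of every other
  decomposable element: a decomposition avoiding \<open>x\<close> would contribute height at least
  \<open>q - 1\<close>, or \<open>(q - 1) / 2\<close> if its two summands agree, on top of \<open>height x\<close>.\<close>

lemma D_of_tall:
  assumes x: "x \<in> A" "q \<le> 2 * height x" and T: "T < q" and d: "d \<in> D" "d \<noteq> 2 * x"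
  obtains y where "y \<in> A" "y \<noteq> x" "d = x + y" "height x + height y + 1 = q" "height y > 0"
proof -
  obtain u v where uv: "u \<in> A" "v \<in> A" "d = u + v" using D_obtain[OF d(1)] .
  have hd: "q \<le> height u + height v + 1" using height_summands uv D_le_F[OF d(1)] by blast
  have "u = x \<or> v = x"
  proof (rule ccontr)
    assume n: "\<not> (u = x \<or> v = x)"
    show False
    proof (cases "u = v")
      case True
      then show False using two_le_T[OF x(1) uv(1)] n hd x(2) T by auto
    next
      case False
      then show False using three_le_T[OF x(1) uv(1,2)] n hd x(2) T by auto
    qed
  qed
  then obtain y where y: "y \<in> A" "d = x + y" using uv by (auto simp: add.commute)
  have "y \<noteq> x" using d(2) y(2) by auto
  moreover have "q \<le> height x + height y + 1"
    using height_summands[OF x(1) y(1)] y(2) D_le_F[OF d(1)] by simp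
  moreover have "height x + height y \<le> T" using two_le_T[OF x(1) y(1)] \<open>y \<noteq> x\<close> by auto
  moreover have "height y > 0" using height_summand_pos[OF x(1)] y(2) D_le_F[OF d(1)] by simp
  ultimately show thesis using that y T by auto
qed

text \<open>Since \<open>T \<le> q - 1\<close> is exhausted by \<open>x\<close> and one partner \<open>y\<close> and partners have positive
  height, \<open>y\<close> is unique. Thus \<open>D\<close> has at most two elements, and \<open>T = q - 1\<close> if \<open>x + y\<close> is one of
  them. The estimates leave only \<open>e = 2\<close>, \<open>\<rho> = 1\<close> and \<open>card D = 2\<close>, which is
  contradictory.\<close>

lemma height_bound_with_tall:
  assumes large: "m \<le> 2 * e" and ne: "D \<noteq> {}"
    and x: "x \<in> A" "q \<le> 2 * height x" and T: "T < q"
  shows "q * card D \<le> e * T + \<rho>"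
proof -
  have e: "2 \<le> e" using two_le_e[OF large] ne by auto
  have hx: "height x \<le> T" using sum_height_mono[of "{x}"] x(1) by simp
  show ?thesis
  proof (cases "D \<subseteq> {2 * x}")
    case True
    then have "card D \<le> 1" using card_mono[OF _ True] by simp
    then have "q * card D \<le> q * 1" by (rule mult_left_mono) simp
    also have "\<dots> \<le> 2 * T" using x(2) hx by simp
    also have "\<dots> \<le> e * T" using e by (rule mult_right_mono) simp
    finally show ?thesis by simp
  next
    case False
    then obtain d where d: "d \<in> D" "d \<noteq> 2 * x" by auto
    obtain y where y: "y \<in> A" "y \<noteq> x" "d = x + y" "height x + height y + 1 = q" "height y > 0"
      using D_of_tall[OF x T d] .
    have sub: "D \<subseteq> {2 * x, x + y}"
    proof
      fix d' assume d': "d' \<in> D"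
      show "d' \<in> {2 * x, x + y}"
      proof (cases "d' = 2 * x")
        case False
        obtain z where z: "z \<in> A" "z \<noteq> x" "d' = x + z" "height z > 0"
          using D_of_tall[OF x T d' False] .
        have "z = y" using three_le_T[OF x(1) y(1) z(1)] y z T by fastforce
        then show ?thesis using z by simp
      qed simp
    qed
    have window: "F < x + y + \<rho>" using summands_window[OF x(1) y(1)] y(4) by simp
    have le: "x + y \<le> F" using D_le_F[OF d(1)] y(3) by simp
    have rho: "1 \<le> \<rho>" using window le by simp
    have T_eq: "T + 1 = q" using two_le_T[OF x(1) y(1)] y(2,4) T by auto
    have q: "3 \<le> q" using y(4,5) x(2) by simp
    show ?thesis
    proof (cases "card D \<le> 1")
      case True
      then have "q * card D \<le> q * 1" by (rule mult_left_mono) simp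
      also have "\<dots> \<le> 2 * T" using q T_eq by simp
      also have "\<dots> \<le> e * T" using e by (rule mult_right_mono) simp
      finally show ?thesis by simp
    next
      case False
      have "card D \<le> card {2 * x, x + y}" by (rule card_mono[OF _ sub]) simp
      then have card_D: "card D = 2" using y(2) False by simp
      then have D_eq: "D = {2 * x, x + y}" using sub y(2) by (intro card_subset_eq) auto
      consider "3 \<le> e" | "e = 2" "2 \<le> \<rho>" | "e = 2" "\<rho> = 1" using e rho by linarith
      then show ?thesis
      proof cases
        case 1
        have "3 * T \<le> e * T" using 1 by (rule mult_right_mono) simp
        moreover have "q * card D = 2 * q" using card_D by simp
        ultimately show ?thesis using q T_eq rho by linarith
      next
        case 2
        then show ?thesis using T_eq card_D by simp
      next
        case 3
        \<comment> \<open>Only two atoms are available, namely \<open>m\<close> and \<open>x\<close>, so \<open>y\<close> is decomposable and the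
          Apery set is \<open>{0, x, 2 * x, 3 * x}\<close>.\<close>
        have m4: "m = 4" using multiplicity_eq card_D 3(1) by simp
        have pos: "x > 0" "y > 0" using A_in x(1) y(1) m_pos by fastforce+
        have "x \<notin> D" using D_eq pos by simp
        then have atom: "x \<in> ns_atoms S" using x(1) by (simp add: D_def)
        have "y \<in> D"
        proof (rule ccontr)
          assume "y \<notin> D"
          then have "{m, x, y} \<subseteq> ns_atoms S"
            using atom y(1) multiplicity_in_ns_atoms[OF numerical] by (auto simp: D_def)
          then have "card {m, x, y} \<le> e" using finite_ns_atoms[OF numerical] by (simp add: card_mono)
          moreover have "m \<noteq> x" "m \<noteq> y" using m_notin_A x(1) y(1) by auto
          ultimately show False using y(2) 3(1) by simp
        qed
        then have y2: "y = 2 * x" using D_eq pos by auto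
        \<comment> \<open>The window \<open>{F - 1 <.. F}\<close> has a single element. It forces \<open>x\<close> to be even, so that
          \<open>2 * x\<close> and \<open>0\<close> are two Apery elements in the same class modulo \<open>4\<close>.\<close>
        have "F = 3 * x" using window le 3(2) y2 by simp
        then have "3 * x + 2 = (q + 1) * 4" using F_eq 3(2) m4 by simp
        then have "(2 * x) mod m = 0 mod m" using m4 by presburger
        moreover have "2 * x \<in> apery S m" using y(1) y2 by (simp add: A_def)
        ultimately have "2 * x = 0"
          using inj_onD[OF inj_on_mod_apery[OF monoid m_in]] zero_in_apery[OF monoid m_pos] by blast
        then show ?thesis using pos by simp
      qed
    qed
  qed
qed

lemma height_bound:
  assumes large: "m \<le> 2 * e"
  shows "q * card D \<le> e * T + \<rho>"
proof (cases "D = {} \<or> q \<le> T")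
  case True
  have "card D \<le> e" using large multiplicity_eq by simp
  then have "q * card D \<le> T * e" if "q \<le> T" using that by (intro mult_mono) auto
  then show ?thesis using True by (auto simp: mult.commute trans_le_add1)
next
  case False
  then show ?thesis
    using height_bound_without_tall[OF large] height_bound_with_tall[OF large] by (metis not_less)
qed

lemma wilf_inequality:
  assumes "m \<le> 2 * e"
  shows "frobenius_number S + 1 \<le> int (num_small_elements S * e)"
proof -
  have "F + 1 + \<rho> = m + q * (e + card D)"
    using F_eq by (simp add: algebra_simps flip: multiplicity_eq)
  also have "\<dots> \<le> m + (q + T) * e + \<rho>" using height_bound[OF assms] by (simp add: algebra_simps)
  finally have "F + 1 \<le> m + (q + T) * e" by simp
  also have "\<dots> \<le> m + num_small_elements S * e"
    using sum_height_le by (intro add_left_mono mult_right_mono) auto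
  finally have "int (F + 1) \<le> int (m + num_small_elements S * e)" by (simp only: of_nat_le_iff)
  then show ?thesis using int_F by simp
qed

end

theorem theorem18:
  fixes S :: "nat set"
  assumes "numerical_semigroup S"
    and "2 * embedding_dimension S \<ge> multiplicity_ns S"
  shows "frobenius_number S + 1 \<le> int (num_small_elements S * embedding_dimension S)"
proof -
  interpret wilf S using assms(1) by unfold_locales
  have "embedding_dimension S = card (ns_atoms S)" using monoid by (rule embedding_dimension_eq)
  then show ?thesis using wilf_inequality assms(2) by simp
qed

end
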